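(* Let $\rho=\lambda/\mu$, let $(s_k(t),1\le k\le d-1)$ be (the first component of) the unique solution of the generalized Skorohod problem associated to the matrix $P$ and the functional $h\mapsto G(h,\beta,\lambda)$ defined in the context, and let $$x_0(t)=\mu\int_0^t s_1(u)\,du,\quad x_1(t)=s_1(t),\quad x_k(t)=s_k(t)-s_{k-1}(t)\ (2\le k\le d-1),\quad x_d(t)=\beta-s_{d-1}(t)-x_0(t).$$ Suppose $2\mu\beta<\lambda<d\mu\beta$ and let $p=\lfloor\rho/\beta\rfloor$. Then $$\lim_{t\to+\infty}(x_p(t),x_{p+1}(t))=\big((p+1)\beta-\rho,\ \rho-p\beta\big),$$ and $x_k(t)\to0$ as $t\to+\infty$ for all $1\leq k\leq d$, $k\notin\{p,p+1\}$.
   Context: Here $\lambda,\mu,\beta>0$ are real numbers and $d\ge3$ is an integer (the condition $2\mu\beta<\lambda<d\mu\beta$ forces $d\ge3$). Functional $G$. For $h=(h_1,\dots,h_{d-1})\in\mathcal D(\mathbb{R}_+,\mathbb{R}^{d-1})$ (càdlàg functions), $\eta>0$ and $F\ge 0$, set $G(h,F,\eta)=(G_k(h,F,\eta),1\le k\le d-1)$, where $$G_1(h,F,\eta)(t)=\mu\int_0^t(2h_2(u)-3h_1(u))\,du-\eta t,$$ $$G_k(h,F,\eta)(t)=\mu\int_0^t\big((k+1)h_{k+1}(u)-(k+1)h_k(u)-h_1(u)\big)\,du,\quad 1<k<d-1,$$ $$G_{d-1}(h,F,\eta)(t)=d\mu\int_0^t\Big[F-h_{d-1}(u)-\mu\int_0^u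 h_1(v)\,dv\Big]du-\mu\int_0^t h_1(u)\,du.$$ The matrix $P=(P_{ij},1\le i,j\le d-1)$ has $P_{i,i-1}=1$ for $2\le i\le d-1$ and all other entries equal to $0$. Generalized Skorohod problem. For $K\ge1$, a functional $G:\mathcal D(\mathbb{R}_+,\mathbb{R}^K)\to\mathcal D(\mathbb{R}_+,\mathbb{R}^K)$ and a non-negative $K\times K$ matrix $P$, a couple of functions $((X(t)),(R(t)))$ with values in $\mathbb{R}^K$ is a solution of the generalized Skorohod problem associated to $G$ and $P$ if: (1) $X(t)=G(X)(t)+(I-P)R(t)$ for all $t\ge0$; (2) $X_k(t)\ge0$ for all $t\ge0$ and $1\le k\le K$; (3) for $1\le k\le K$, $t\mapsto R_k(t)$ is non-decreasing, $R_k(0)=0$ and $\int_{\mathbb{R}_+}X_k(t)\,dR_k(t)=0$. *)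

theory Defs
  imports "HOL-Analysis.Analysis"
begin

text \<open>
  An element of $D(\mathbb{R}_+, \mathbb{R}^K)$ is a family \<open>h :: nat \<Rightarrow> real \<Rightarrow> real\<close>, the
  component \<open>h k\<close> being relevant for \<open>1 \<le> k \<le> K\<close> only, and at times \<open>t \<ge> 0\<close> only.
\<close>

definition cadlag :: "(real \<Rightarrow> real) \<Rightarrow> bool" where
  "cadlag f \<longleftrightarrow>
     (\<forall>t\<ge>0. (f \<longlongrightarrow> f t) (at_right t)) \<and> (\<forall>t>0. \<exists>l. (f \<longlongrightarrow> l) (at_left t))"

text \<open>
  Right-continuity of \<open>R\<close> makes \<open>dR k\<close> the Stieltjes measure \<open>interval_measure\<close>
  of \<open>R k\<close>, extended by \<open>R k 0 = 0\<close> to negative times (so there is no atom at \<open>0\<close>); without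
  right-continuity, \<open>interval_measure\<close> would be meaningless.
  If \<open>P\<close> is strictly lower triangular, right-continuity and left limits of \<open>R\<close> follow from
  those of \<open>X\<close> and \<open>G X\<close> by the first equation.  The integral of \<open>X k\<close> is a nonnegative one
  because \<open>X k\<close> is nonnegative.
\<close>

definition generalized_skorohod_solution ::
  "nat \<Rightarrow> ((nat \<Rightarrow> real \<Rightarrow> real) \<Rightarrow> nat \<Rightarrow> real \<Rightarrow> real) \<Rightarrow> (nat \<Rightarrow> nat \<Rightarrow> real) \<Rightarrow>
   (nat \<Rightarrow> real \<Rightarrow> real) \<Rightarrow> (nat \<Rightarrow> real \<Rightarrow> real) \<Rightarrow> bool" where
  "generalized_skorohod_solution K G P X R \<longleftrightarrow>
     (\<forall>k\<in>{1..K}. cadlag (X k) \<and> cadlag (R k)) \<and>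
     (\<forall>t\<ge>0. \<forall>k\<in>{1..K}.
        X k t = G X k t + (\<Sum>j=1..K. ((if k = j then 1 else 0) - P k j) * R j t)) \<and>
     (\<forall>t\<ge>0. \<forall>k\<in>{1..K}. X k t \<ge> 0) \<and>
     (\<forall>k\<in>{1..K}. mono_on {0..} (R k) \<and> R k 0 = 0 \<and>
        (\<integral>\<^sup>+t\<in>{0..}. ennreal (X k t) \<partial>interval_measure (\<lambda>t. R k (max 0 t))) = 0)"

definition G_functional ::
  "nat \<Rightarrow> real \<Rightarrow> (nat \<Rightarrow> real \<Rightarrow> real) \<Rightarrow> real \<Rightarrow> real \<Rightarrow> nat \<Rightarrow> real \<Rightarrow> real" where
  "G_functional d \<mu> h F \<eta> k t =
     (if k = 1 then
        \<mu> * integral {0..t} (\<lambda>u. 2 * h 2 u - 3 * h 1 u) - \<eta> * t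
      else if k < d - 1 then
        \<mu> * integral {0..t}
              (\<lambda>u. (real k + 1) * h (k + 1) u - (real k + 1) * h k u - h 1 u)
      else
        real d * \<mu> * integral {0..t} (\<lambda>u. F - h (d - 1) u - \<mu> * integral {0..u} (h 1))
          - \<mu> * integral {0..t} (h 1))"

definition P_matrix :: "nat \<Rightarrow> nat \<Rightarrow> real" where
  "P_matrix i j = (if 2 \<le> i \<and> j = i - 1 then 1 else 0)"

definition fluid_state ::
  "nat \<Rightarrow> real \<Rightarrow> real \<Rightarrow> (nat \<Rightarrow> real \<Rightarrow> real) \<Rightarrow> nat \<Rightarrow> real \<Rightarrow> real" where
  "fluid_state d \<mu> \<beta> s k t =
     (if k = 0 then \<mu> * integral {0..t} (s 1)
      else if k = 1 then s 1 t
      else if k < d then s k t - s (k - 1) t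
      else \<beta> - s (d - 1) t - \<mu> * integral {0..t} (s 1))"

end

theory Submission
  imports Defs
begin

text \<open>
  Since \<open>s k \<le> \<beta>\<close> for all \<open>k\<close> and \<open>2 \<mu> \<beta> < lam\<close>, the first coordinate is pushed down faster than it
  can be filled, so \<open>s 1\<close> and \<open>x0\<close> vanish.  The partial sums \<open>T k = s 1 + \<dots> + s k\<close> then satisfy
  an obstacle problem: \<open>T k\<close> has the drift \<open>\<mu> ((k + 1) (T (k + 1) - T k) - T k) - lam\<close> and is
  reflected above \<open>T (k - 1)\<close> by \<open>R k\<close>, where \<open>T d - T (d - 1) = \<beta>\<close>.  The drift is cooperative and
  contracts the maximum norm, so the distance of \<open>T\<close> to the explicit stationary solution of the
  obstacle problem decays exponentially.
\<close>

section \<open>Right-continuous functions with left limits\<close>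

text \<open>\<open>f\<close> is the pointwise limit of the functions \<open>f (r n t)\<close>, each
  measurable because it factors through an integer-valued floor. Here \<open>r n t\<close> is the
  least multiple of \<open>1 / real (Suc n)\<close> strictly above \<open>t\<close>, so
  \<open>t\<close> is approached only from the right.\<close>

lemma right_continuous_borel_measurable:
  fixes f :: "real \<Rightarrow> real"
  assumes "\<And>t. (f \<longlongrightarrow> f t) (at_right t)"
  shows "f \<in> borel_measurable borel"
proof (rule borel_measurable_LIMSEQ_metric)
  define r where "r n t = (real_of_int \<lfloor>real (Suc n) * t\<rfloor> + 1) / real (Suc n)" for n and t :: real
  show "(\<lambda>t. f (r n t)) \<in> borel_measurable borel" for n
  proof -
    have "(\<lambda>t::real. \<lfloor>real (Suc n) * t\<rfloor>) \<in> measurable borel (count_space UNIV)"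
      by measurable
    moreover have "(\<lambda>z::int. f ((real_of_int z + 1) / real (Suc n))) \<in> measurable (count_space UNIV) borel"
      by simp
    ultimately show ?thesis
      unfolding r_def by (rule measurable_compose)
  qed
  show "(\<lambda>n. f (r n t)) \<longlonglongrightarrow> f t" for t
  proof -
    have gt: "r n t > t" for n
    proof -
      have "real (Suc n) * t < real_of_int \<lfloor>real (Suc n) * t\<rfloor> + 1" by linarith
      then show ?thesis unfolding r_def by (simp add: pos_less_divide_eq mult.commute)
    qed
    have le: "r n t \<le> t + 1 / real (Suc n)" for n
    proof -
      have "real_of_int \<lfloor>real (Suc n) * t\<rfloor> + 1 \<le> real (Suc n) * t + 1" by linarith
      then have "r n t \<le> (real (Suc n) * t + 1) / real (Suc n)"
        unfolding r_def by (rule divide_right_mono) simp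
      then show ?thesis by (simp add: add_divide_distrib del: of_nat_Suc)
    qed
    have "(\<lambda>n. t + 1 / real (Suc n)) \<longlonglongrightarrow> t + 0"
      by (intro tendsto_add tendsto_const LIMSEQ_Suc[OF lim_1_over_n])
    then have lim: "(\<lambda>n. t + 1 / real (Suc n)) \<longlonglongrightarrow> t" by (simp only: add_0_right)
    have "(\<lambda>n. r n t) \<longlonglongrightarrow> t"
      by (rule tendsto_sandwich[OF _ _ tendsto_const lim])
        (intro always_eventually allI le less_imp_le gt)+
    then have "filterlim (\<lambda>n. r n t) (at_right t) sequentially"
      using gt gt[THEN less_imp_neq, symmetric] by (simp add: filterlim_at)
    then show ?thesis by (rule filterlim_compose[OF assms])
  qed
qed

lemma cadlag_extension_right_continuous:
  assumes "cadlag f"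
  shows "((\<lambda>t. f (max 0 t)) \<longlongrightarrow> f (max 0 t)) (at_right t)"
proof (cases "t < 0")
  case True
  have "eventually (\<lambda>u. f (max 0 t) = f (max 0 u)) (at_right t)"
    using eventually_at_right_less[of t] eventually_at_right[of t 0] True
    by (auto simp: eventually_at_right[OF True] intro!: exI[of _ 0])
  then show ?thesis by (rule tendsto_eventually[OF eventually_mono]) auto
next
  case False
  have "(f \<longlongrightarrow> f t) (at_right t)"
    using assms False by (auto simp: cadlag_def)
  moreover have "eventually (\<lambda>u. f u = f (max 0 u)) (at_right t)"
    using eventually_at_right_less[of t] False by (auto elim!: eventually_mono)
  ultimately show ?thesis
    using False by (auto intro: Lim_transform_eventually)
qed

lemma cadlag_left_limit: "cadlag f \<Longrightarrow> t > 0 \<Longrightarrow> \<exists>l. (f \<longlongrightarrow> l) (at_left t)"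
  by (simp add: cadlag_def)

text \<open>Bisection: bounds on two adjacent intervals combine, and the one-sided limits at a point
  bound \<open>f\<close> on a small interval around it.\<close>

lemma cadlag_bounded:
  assumes "cadlag f" "0 \<le> b"
  shows "\<exists>C. \<forall>t\<in>{0..b}. \<bar>f t\<bar> \<le> C"
proof -
  \<comment> \<open>Bolzano's local condition also concerns intervals reaching below 0. Intersecting
    with \<open>{0..}\<close> discards that part, and at \<open>x = 0\<close> leaves nothing to
    bound on the left.\<close>
  let ?P = "\<lambda>a b. \<exists>C. \<forall>t\<in>{a..b} \<inter> {0..}. \<bar>f t\<bar> \<le> C"
  have "?P 0 b"
  proof (induction rule: Bolzano[OF assms(2), of ?P, case_names trans local])
    case (trans a b c)
    then obtain C D where "\<forall>t\<in>{a..b} \<inter> {0..}. \<bar>f t\<bar> \<le> C" "\<forall>t\<in>{b..c} \<inter> {0..}. \<bar>f t\<bar> \<le> D"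
      by blast
    then have "\<forall>t\<in>{a..c} \<inter> {0..}. \<bar>f t\<bar> \<le> max C D"
      by (metis Int_iff atLeastAtMost_iff linorder_le_cases max.coboundedI1 max.coboundedI2)
    then show ?case by blast
  next
    case (local x)
    have "(f \<longlongrightarrow> f x) (at_right x)" using assms local by (auto simp: cadlag_def)
    from tendstoD[OF this, of 1] obtain r where r: "r > x" "\<And>t. x < t \<Longrightarrow> t < r \<Longrightarrow> dist (f t) (f x) < 1"
      by (auto simp: eventually_at_right[OF less_add_one])
    have "\<exists>l<x. \<exists>D. \<forall>t. l < t \<and> t < x \<and> 0 \<le> t \<longrightarrow> \<bar>f t\<bar> \<le> D"
    proof (cases "x = 0")
      case True
      then show ?thesis by (intro exI[of _ "-1"]) auto
    next
      case False
      then obtain m where "(f \<longlongrightarrow> m) (at_left x)"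
        using assms local by (metis cadlag_def less_eq_real_def)
      from tendstoD[OF this, of 1] obtain l where "l < x" and l: "\<And>t. l < t \<Longrightarrow> t < x \<Longrightarrow> dist (f t) m < 1"
        by (auto simp: eventually_at_left[of "x - 1"])
      have "\<bar>f t\<bar> \<le> \<bar>m\<bar> + 1" if "l < t" "t < x" for t
        using l[OF that] by (simp add: dist_real_def)
      then show ?thesis using \<open>l < x\<close> by blast
    qed
    then obtain l D where l: "l < x" "\<And>t. l < t \<Longrightarrow> t < x \<Longrightarrow> 0 \<le> t \<Longrightarrow> \<bar>f t\<bar> \<le> D" by auto
    define e where "e = min (x - l) (r - x)"
    have "\<bar>f t\<bar> \<le> max D (\<bar>f x\<bar> + 1)" if "a \<le> x" "x \<le> b" "b - a < e" "t \<in> {a..b} \<inter> {0..}" for a b t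
    proof (cases t x rule: linorder_cases)
      case less
      then show ?thesis using l(2)[of t] that by (auto simp: e_def)
    next
      case equal
      then show ?thesis by auto
    next
      case greater
      then show ?thesis using r(2)[of t] that by (auto simp: e_def dist_real_def)
    qed
    moreover have "e > 0" using l r by (simp add: e_def)
    ultimately show ?case by blast
  qed
  then show ?thesis by auto
qed

text \<open>Boundedness on compact intervals is combined with Borel measurability. The latter is
  obtained for the extension by the constant \<open>f 0\<close> to negative times, which is
  right-continuous on the whole line.\<close>

lemma cadlag_integrable_on:
  assumes "cadlag f" "0 \<le> a"
  shows "f integrable_on {a..b}"
proof (cases "a \<le> b")
  case True
  then obtain C where C: "\<And>t. t \<in> {0..b} \<Longrightarrow> \<bar>f t\<bar> \<le> C" using cadlag_bounded[OF assms(1), of b] assms(2) by (meson order.trans)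
  have "(\<lambda>t. f (max 0 t)) \<in> borel_measurable borel"
    by (intro right_continuous_borel_measurable cadlag_extension_right_continuous assms)
  then have "(\<lambda>t. f (max 0 t)) \<in> borel_measurable (lebesgue_on {a..b})"
    by (intro borel_measurable_if_I measurable_restrict_space1 measurable_completion) simp_all
  then have "(\<lambda>t. f (max 0 t)) integrable_on {a..b}"
    by (rule measurable_bounded_by_integrable_imp_integrable_real[where g = "\<lambda>_. C"])
       (use C assms(2) in auto)
  then show ?thesis
    by (rule integrable_eq) (use assms(2) in auto)
qed auto

lemma continuous_on_half_lineI:
  fixes f :: "real \<Rightarrow> 'a::topological_space"
  assumes "\<And>b. b > a \<Longrightarrow> continuous_on {a..b} f"
  shows "continuous_on {a..} f"
  unfolding continuous_on_def
proof
  fix t assume "t \<in> {a..}"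
  then have "(f \<longlongrightarrow> f t) (at t within {a..t + 1})"
    using assms[of "t + 1"] by (auto simp: continuous_on_def)
  moreover have "at t within {a..t + 1} = at t within {a..}"
    by (rule at_within_nhd[of _ "{..<t + 1}"]) auto
  ultimately show "(f \<longlongrightarrow> f t) (at t within {a..})" by simp
qed

lemma continuous_on_half_line_integral:
  fixes f :: "real \<Rightarrow> real"
  assumes "\<And>b. f integrable_on {a..b}"
  shows "continuous_on {a..} (\<lambda>t. integral {a..t} f)"
  by (intro continuous_on_half_lineI indefinite_integral_continuous_1 assms)

section \<open>Comparison principles on the half-line\<close>

text \<open>After the last time up to \<open>t\<close> at which \<open>f\<close> is nonpositive,
  \<open>f\<close> is positive and hence cannot end above its value at that time. The premise
  \<open>f a \<ge> 0\<close> in \<open>dec\<close> follows from continuity and lets applications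
  control \<open>f\<close> on the closed interval, left endpoint included.\<close>

lemma nonpos_if_antimono_while_pos:
  fixes f :: "real \<Rightarrow> real"
  assumes cont: "continuous_on {0..} f" and "f 0 \<le> 0"
    and dec: "\<And>a b. 0 \<le> a \<Longrightarrow> a < b \<Longrightarrow> (\<And>u. a < u \<Longrightarrow> u \<le> b \<Longrightarrow> f u > 0) \<Longrightarrow>
      f a \<ge> 0 \<Longrightarrow> f b \<le> f a"
    and "t \<ge> 0"
  shows "f t \<le> 0"
proof (rule ccontr)
  assume "\<not> f t \<le> 0"
  define S where "S = {u \<in> {0..t}. f u \<le> 0}"
  have "closed S" unfolding S_def
    by (intro continuous_on_closed_Collect_le continuous_on_subset[OF cont]) auto
  moreover have "S \<noteq> {}" "bdd_above S" using assms by (auto simp: S_def)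
  ultimately have a: "Sup S \<in> S" by (simp add: closed_contains_Sup)
  have pos: "f u > 0" if "Sup S < u" "u \<le> t" for u
  proof (rule ccontr)
    assume "\<not> f u > 0"
    then have "u \<in> S" using that a by (auto simp: S_def)
    then show False using that cSup_upper[of u S] \<open>bdd_above S\<close> by auto
  qed
  have lt: "Sup S < t" using a \<open>\<not> f t \<le> 0\<close> by (cases "Sup S = t") (auto simp: S_def)
  have "f (Sup S) \<ge> 0"
  proof (rule tendsto_lowerbound)
    have "continuous_on {Sup S..t} f" using a by (intro continuous_on_subset[OF cont]) (auto simp: S_def)
    then show "(f \<longlongrightarrow> f (Sup S)) (at_right (Sup S))"
      using lt by (simp add: continuous_on_Icc_at_rightD)
    show "eventually (\<lambda>u. 0 \<le> f u) (at_right (Sup S))"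
      using pos by (intro eventually_at_rightI[OF _ lt]) (simp add: less_imp_le)
  qed simp
  then have "f t \<le> f (Sup S)" using dec[of "Sup S" t] a pos lt by (auto simp: S_def)
  then show False using a \<open>\<not> f t \<le> 0\<close> by (auto simp: S_def)
qed

text \<open>For a finite family, the times at which some member is nonnegative form a closed set, so
  a first such time is attained. There all members are at most 0 by left-continuity and one of them
  equals 0, which \<open>no_contact\<close> forbids.\<close>

lemma neg_if_no_first_contact:
  fixes f :: "'i \<Rightarrow> real \<Rightarrow> real"
  assumes fin: "finite I" and cont: "\<And>k. k \<in> I \<Longrightarrow> continuous_on {0..} (f k)"
    and init: "\<And>k. k \<in> I \<Longrightarrow> f k 0 < 0"
    and no_contact: "\<And>t k. t > 0 \<Longrightarrow> (\<And>j u. j \<in> I \<Longrightarrow> 0 \<le> u \<Longrightarrow> u < t \<Longrightarrow> f j u < 0) \<Longrightarrow>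
      (\<And>j. j \<in> I \<Longrightarrow> f j t \<le> 0) \<Longrightarrow> k \<in> I \<Longrightarrow> f k t \<noteq> 0"
    and "k \<in> I" "t \<ge> 0"
  shows "f k t < 0"
proof (rule ccontr)
  assume "\<not> f k t < 0"
  define S where "S = (\<Union>k\<in>I. {u \<in> {0..}. 0 \<le> f k u})"
  have "closed S" unfolding S_def
    by (intro closed_UN fin ballI continuous_on_closed_Collect_le cont) auto
  moreover have "t \<in> S" using \<open>\<not> f k t < 0\<close> assms(5,6) unfolding S_def by (intro UN_I[of k]) auto
  moreover have "bdd_below S" by (auto simp: S_def intro!: bdd_belowI[of _ 0])
  moreover define T where "T = Inf S"
  ultimately have "T \<in> S" using closed_contains_Inf[of S] by auto
  then obtain i where i: "i \<in> I" "f i T \<ge> 0" "T \<ge> 0" by (auto simp only: S_def UN_iff mem_Collect_eq atLeast_iff)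
  have "T \<noteq> 0" using init[OF i(1)] i(2) by (intro notI) simp
  then have "T > 0" using i by simp
  have before: "f j u < 0" if "j \<in> I" "0 \<le> u" "u < T" for j u
  proof (rule ccontr)
    assume "\<not> f j u < 0"
    then have "u \<in> S" using that unfolding S_def by (intro UN_I[of j]) auto
    then show False using cInf_lower[of u S] \<open>bdd_below S\<close> that by (auto simp: T_def)
  qed
  have at: "f j T \<le> 0" if "j \<in> I" for j
  proof (rule tendsto_upperbound)
    have "(f j \<longlongrightarrow> f j T) (at T within {0..T})"
      using continuous_on_subset[OF cont[OF that], of "{0..T}"] \<open>T > 0\<close> by (auto simp: continuous_on_def)
    then show "(f j \<longlongrightarrow> f j T) (at_left T)"
      using \<open>T > 0\<close> by (simp add: at_within_Icc_at_left)
    show "eventually (\<lambda>u. f j u \<le> 0) (at_left T)"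
      using before[OF that] \<open>T > 0\<close>
      by (auto simp: eventually_at_left[OF \<open>T > 0\<close>] intro!: exI[of _ 0] less_imp_le)
  qed auto
  show False using no_contact[OF \<open>T > 0\<close> before at i(1)] at[OF i(1)] i by auto
qed


lemma not_left_max_if_deriv_neg:
  fixes q :: "real \<Rightarrow> real"
  assumes "(q has_real_derivative l) (at t within {0..})" "l < 0" "0 \<le> c" "c < t"
    and "\<And>u. c < u \<Longrightarrow> u < t \<Longrightarrow> q u \<le> q t"
  shows False
proof -
  obtain e where e: "e > 0" "\<And>h. h > 0 \<Longrightarrow> t - h \<in> {0..} \<Longrightarrow> h < e \<Longrightarrow> q t < q (t - h)"
    using has_real_derivative_neg_dec_left[OF assms(1,2)] by auto
  define h where "h = min e (t - c) / 2"
  have "0 < h" "h < e" "c < t - h" using e(1) assms(4) by (auto simp: h_def min_def field_simps)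
  then show False using e(2)[of h] assms(5)[of "t - h"] assms(3) by auto
qed

section \<open>Complementarity\<close>

lemma emeasure_stieltjes_Ioc:
  assumes "cadlag R" "mono_on {0..} R" "0 \<le> a" "a \<le> b"
  shows "emeasure (interval_measure (\<lambda>t. R (max 0 t))) {a<..b} = ennreal (R b - R a)"
proof -
  have "R (max 0 t) \<le> R (max 0 u)" if "t \<le> u" for t u
    using that by (auto intro!: mono_onD[OF assms(2)])
  then show ?thesis
    using assms(3,4) cadlag_extension_right_continuous[OF assms(1)]
    by (subst emeasure_interval_measure_Ioc) (auto simp: continuous_within)
qed

text \<open>Markov's inequality: \<open>\<epsilon>\<close> times the measure of \<open>B\<close> is
  at most the vanishing integral of \<open>X\<close>.\<close>

lemma complementarity_null_set:
  fixes F X :: "real \<Rightarrow> real"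
  assumes "(\<integral>\<^sup>+t\<in>{0..}. ennreal (X t) \<partial>interval_measure F) = 0"
    and "B \<in> sets borel" "B \<subseteq> {0..}" "\<epsilon> > 0" "\<And>t. t \<in> B \<Longrightarrow> X t \<ge> \<epsilon>"
  shows "emeasure (interval_measure F) B = 0"
proof -
  have "ennreal \<epsilon> * emeasure (interval_measure F) B
      = (\<integral>\<^sup>+t. ennreal \<epsilon> * indicator B t \<partial>interval_measure F)"
    using assms(2) by (subst nn_integral_cmult_indicator) auto
  also have "\<dots> \<le> (\<integral>\<^sup>+t\<in>{0..}. ennreal (X t) \<partial>interval_measure F)"
    using assms(3,5) by (intro nn_integral_mono) (auto simp: indicator_def intro!: ennreal_leI)
  finally show ?thesis using assms(1,4) by simp
qed

text \<open>The increment \<open>R b - R a\<close> is the measure of the half-open interval from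
  \<open>a\<close> to \<open>b\<close>, so the lower bound on \<open>X\<close> is required only
  after \<open>a\<close>.\<close>

lemma complementarity_const:
  assumes "cadlag R" "mono_on {0..} R"
    and "(\<integral>\<^sup>+t\<in>{0..}. ennreal (X t) \<partial>interval_measure (\<lambda>t. R (max 0 t))) = 0"
    and "0 \<le> a" "a \<le> b" "\<epsilon> > 0" "\<And>t. a < t \<Longrightarrow> t \<le> b \<Longrightarrow> X t \<ge> \<epsilon>"
  shows "R a = R b"
proof -
  have "emeasure (interval_measure (\<lambda>t. R (max 0 t))) {a<..b} = 0"
    by (rule complementarity_null_set[OF assms(3) _ _ assms(6)]) (use assms(4,7) in auto)
  then have "R b \<le> R a"
    using assms(4,5) by (simp add: emeasure_stieltjes_Ioc[OF assms(1,2)] ennreal_eq_0_iff)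
  moreover have "R a \<le> R b" using assms(4,5) by (auto intro!: mono_onD[OF assms(2)])
  ultimately show ?thesis by simp
qed

text \<open>The jump \<open>R t - l\<close> is the mass of the atom at \<open>t\<close>, and a point
  where \<open>X\<close> is positive carries no mass.\<close>

lemma complementarity_no_jump:
  assumes "cadlag R" "mono_on {0..} R"
    and null: "(\<integral>\<^sup>+t\<in>{0..}. ennreal (X t) \<partial>interval_measure (\<lambda>t. R (max 0 t))) = 0"
    and "t > 0" "X t > 0" "(R \<longlongrightarrow> l) (at_left t)"
  shows "l = R t"
proof -
  let ?M = "interval_measure (\<lambda>t. R (max 0 t))"
  \<comment> \<open>These points increase to \<open>t\<close> without reaching it and stay
    nonnegative, so the intervals \<open>{a n<..t}\<close> shrink to the singleton
    \<open>{t}\<close>.\<close>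
  define a where "a n = t - t / real (Suc n)" for n
  have a: "0 \<le> a n" "a n < t" for n
    using \<open>t > 0\<close> by (auto simp: a_def field_simps)
  have "(\<lambda>n. t - t / real (Suc n)) \<longlonglongrightarrow> t - 0"
    by (intro tendsto_diff tendsto_const LIMSEQ_Suc[OF lim_const_over_n])
  then have lim_a: "a \<longlonglongrightarrow> t" by (simp add: a_def[abs_def])
  then have "filterlim a (at_left t) sequentially"
    using a(2) a(2)[THEN less_imp_neq] by (simp add: filterlim_at)
  then have "(\<lambda>n. R (a n)) \<longlonglongrightarrow> l" by (rule filterlim_compose[OF assms(6)])
  then have "(\<lambda>n. ennreal (R t - R (a n))) \<longlonglongrightarrow> ennreal (R t - l)"
    by (intro tendsto_intros)
  moreover have "(\<lambda>n. emeasure ?M {a n<..t}) \<longlonglongrightarrow> emeasure ?M (\<Inter>n. {a n<..t})"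
  proof (rule Lim_emeasure_decseq)
    have "a m \<le> a n" if "m \<le> n" for m n
      using that \<open>t > 0\<close> by (auto simp: a_def intro!: divide_left_mono)
    then show "decseq (\<lambda>n. {a n<..t})"
      by (force simp: decseq_def)
    show "emeasure ?M {a n<..t} \<noteq> \<infinity>" for n
      using a[of n] by (simp add: emeasure_stieltjes_Ioc[OF assms(1,2)])
  qed auto
  moreover have "emeasure ?M {a n<..t} = ennreal (R t - R (a n))" for n
    using a[of n] by (simp add: emeasure_stieltjes_Ioc[OF assms(1,2)])
  moreover have "(\<Inter>n. {a n<..t}) = {t}"
  proof -
    have "t \<le> u" if "\<And>n. a n < u" for u
      using LIMSEQ_le_const2[OF lim_a, of u] less_imp_le[OF that] by auto
    then show ?thesis using a(2) by (force intro: antisym)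
  qed
  moreover have "emeasure ?M {t} = 0"
    by (rule complementarity_null_set[OF null _ _ \<open>X t > 0\<close>]) (use \<open>t > 0\<close> in auto)
  ultimately have "ennreal (R t - l) = 0"
    using LIMSEQ_unique by fastforce
  then have "R t \<le> l" by (simp add: ennreal_eq_0_iff)
  moreover have "l \<le> R t"
  proof (rule tendsto_upperbound[OF assms(6)])
    show "eventually (\<lambda>u. R u \<le> R t) (at_left t)"
      using \<open>t > 0\<close> by (auto simp: eventually_at_left[OF \<open>t > 0\<close>] intro!: exI[of _ 0] mono_onD[OF assms(2)])
  qed auto
  ultimately show ?thesis by simp
qed

text \<open>A continuous positive \<open>X\<close> is bounded away from 0 on \<open>{c..b}\<close>
  for each \<open>c\<close> in between, so \<open>R\<close> is constant there. Letting
  \<open>c\<close> decrease to \<open>a\<close> uses right-continuity of \<open>R\<close> and allows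
  \<open>X\<close> to vanish at \<open>a\<close>.\<close>

lemma complementarity_const_cont:
  assumes "cadlag R" "mono_on {0..} R"
    and "(\<integral>\<^sup>+t\<in>{0..}. ennreal (X t) \<partial>interval_measure (\<lambda>t. R (max 0 t))) = 0"
    and cont: "continuous_on {0..} X"
    and "0 \<le> a" "a \<le> b" and pos: "\<And>t. a < t \<Longrightarrow> t \<le> b \<Longrightarrow> X t > 0"
  shows "R a = R b"
proof (cases "a = b")
  case False
  then have "a < b" using \<open>a \<le> b\<close> by simp
  have eq: "R b = R c" if c: "a < c" "c < b" for c
  proof -
    have "\<exists>u\<in>{c..b}. \<forall>t\<in>{c..b}. X u \<le> X t"
      by (intro continuous_attains_inf continuous_on_subset[OF cont]) (use c \<open>0 \<le> a\<close> in auto)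
    then obtain u where "u \<in> {c..b}" "\<And>t. t \<in> {c..b} \<Longrightarrow> X u \<le> X t" by blast
    then show ?thesis
      using complementarity_const[OF assms(1-3), of c b "X u"] c pos[of u] \<open>0 \<le> a\<close> by auto
  qed
  have "(R \<longlongrightarrow> R a) (at_right a)" using assms(1,5) by (simp add: cadlag_def)
  moreover have "(R \<longlongrightarrow> R b) (at_right a)"
    using eq by (intro tendsto_eventually)
      (auto simp: eventually_at_right[OF \<open>a < b\<close>] intro!: exI[of _ b] \<open>a < b\<close> dest: sym)
  ultimately show ?thesis by (rule tendsto_unique[rotated]) simp
qed simp

section \<open>Continuity of the solution\<close>

locale fluid_limit =
  fixes lam \<mu> \<beta> :: real and d :: nat and s R :: "nat \<Rightarrow> real \<Rightarrow> real"
  assumes mu_pos: "\<mu> > 0" and d_ge: "d \<ge> 3"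
    and sol: "generalized_skorohod_solution (d - 1) (\<lambda>h. G_functional d \<mu> h \<beta> lam) P_matrix s R"
begin

lemma cadlag_s: "1 \<le> k \<Longrightarrow> k < d \<Longrightarrow> cadlag (s k)"
  and cadlag_R: "1 \<le> k \<Longrightarrow> k < d \<Longrightarrow> cadlag (R k)"
  and s_nonneg: "1 \<le> k \<Longrightarrow> k < d \<Longrightarrow> t \<ge> 0 \<Longrightarrow> s k t \<ge> 0"
  and R_mono: "1 \<le> k \<Longrightarrow> k < d \<Longrightarrow> mono_on {0..} (R k)"
  and R_0: "1 \<le> k \<Longrightarrow> k < d \<Longrightarrow> R k 0 = 0"
  and complementarity: "1 \<le> k \<Longrightarrow> k < d \<Longrightarrow>
    (\<integral>\<^sup>+t\<in>{0..}. ennreal (s k t) \<partial>interval_measure (\<lambda>t. R k (max 0 t))) = 0"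
  using sol by (auto simp: generalized_skorohod_solution_def)

definition x0 where "x0 t = \<mu> * integral {0..t} (s 1)"

text \<open>
  With \<open>s d\<close> read as \<open>\<beta> - x0\<close> and \<open>R 0 t\<close> as \<open>lam * t\<close>, the three cases of \<^const>\<open>G_functional\<close>
  become one.
\<close>

definition y where "y k t = (if k < d then s k t else \<beta> - x0 t)"

definition drift where "drift k t = \<mu> * ((real k + 1) * (y (k + 1) t - y k t) - s 1 t)"

definition push where "push k t = (if k = 0 then lam * t else R k t)"

lemma x0_continuous: "continuous_on {0..} x0"
  unfolding x0_def[abs_def] using d_ge
  by (intro continuous_intros continuous_on_half_line_integral cadlag_integrable_on cadlag_s) auto

lemma y_integrable:
  assumes "1 \<le> k" "0 \<le> a"
  shows "y k integrable_on {a..b}"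
proof (cases "k < d")
  case True
  then show ?thesis using cadlag_s[of k] assms by (simp add: y_def[abs_def] cadlag_integrable_on)
next
  case False
  then show ?thesis using assms(2)
    by (auto simp: y_def[abs_def] intro!: integrable_continuous_real continuous_intros
      continuous_on_subset[OF x0_continuous])
qed

lemma s_integrable: "1 \<le> k \<Longrightarrow> k < d \<Longrightarrow> 0 \<le> a \<Longrightarrow> s k integrable_on {a..b}"
  by (intro cadlag_integrable_on cadlag_s)

lemma drift_integrable: "1 \<le> k \<Longrightarrow> 0 \<le> a \<Longrightarrow> drift k integrable_on {a..b}"
  unfolding drift_def[abs_def] using d_ge
  by (intro integrable_on_mult_right integrable_diff y_integrable s_integrable) auto

text \<open>Since \<open>P_matrix\<close> is a shift, row \<open>k\<close> of the reflection term is
  \<open>R k - R (k - 1)\<close>. For \<open>k = 1\<close> the missing predecessor is supplied by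
  the term \<open>- lam * t\<close> of the functional, and for \<open>k = d - 1\<close> the value
  \<open>y d\<close> supplies the missing successor.\<close>

lemma s_eq:
  assumes "1 \<le> k" "k < d" "t \<ge> 0"
  shows "s k t = integral {0..t} (drift k) + push k t - push (k - 1) t"
proof -
  have "s k t = G_functional d \<mu> s \<beta> lam k t
      + (\<Sum>j=1..d-1. ((if k = j then 1 else 0) - P_matrix k j) * R j t)"
    using sol assms by (auto simp: generalized_skorohod_solution_def)
  \<comment> \<open>For \<open>k = 1\<close> the index \<open>k - 1 = 0\<close> lies outside the
    range of summation, in agreement with the zero first row of \<open>P_matrix\<close>.\<close>
  also have "(\<Sum>j=1..d-1. ((if k = j then 1 else 0) - P_matrix k j) * R j t)
      = (\<Sum>j=1..d-1. (if j = k then R j t else 0) - (if j = k - 1 then R j t else 0))"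
    by (intro sum.cong) (auto simp: P_matrix_def)
  also have "\<dots> = R k t - (if k = 1 then 0 else R (k - 1) t)"
    using assms by (simp add: sum_subtractf) auto
  also have "G_functional d \<mu> s \<beta> lam k t = integral {0..t} (drift k) - (if k = 1 then lam * t else 0)"
  proof (cases "k < d - 1")
    case True
    then have "drift k = (\<lambda>u. \<mu> * ((real k + 1) * (s (k + 1) u - s k u) - s 1 u))"
      using True by (auto simp: drift_def y_def fun_eq_iff)
    then have "integral {0..t} (drift k)
        = \<mu> * integral {0..t} (\<lambda>u. (real k + 1) * (s (k + 1) u - s k u) - s 1 u)"
      by (simp only: integral_mult_right)
    then show ?thesis
      using True assms(1) by (auto simp: G_functional_def algebra_simps numeral_2_eq_2)
  next
    case False
    then have k: "k = d - 1" "k \<noteq> 1" "Suc k = d" using assms d_ge by auto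
    have "integral {0..t} (drift k) = integral {0..t} (\<lambda>u. real d * \<mu> * (y d u - y k u) - \<mu> * s 1 u)"
      using k by (intro integral_cong) (auto simp: drift_def algebra_simps of_nat_diff)
    also have "\<dots> = real d * \<mu> * integral {0..t} (\<lambda>u. y d u - y k u) - \<mu> * integral {0..t} (s 1)"
      using assms d_ge
      by (subst integral_diff) (auto intro!: integrable_on_mult_right integrable_diff y_integrable s_integrable
        simp flip: integral_mult_right)
    also have "integral {0..t} (\<lambda>u. y d u - y k u)
        = integral {0..t} (\<lambda>u. \<beta> - s (d - 1) u - \<mu> * integral {0..u} (s 1))"
      using k assms by (intro integral_cong) (auto simp: y_def x0_def)
    finally show ?thesis using k by (simp add: G_functional_def)
  qed
  finally show ?thesis using assms by (auto simp: push_def)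
qed

lemma push_mono_on: "k < d \<Longrightarrow> lam \<ge> 0 \<Longrightarrow> mono_on {0..} (push k)"
  using R_mono[of k] by (auto simp: push_def mono_on_def intro!: mult_left_mono)

lemma drift_integral_continuous: "1 \<le> k \<Longrightarrow> continuous_on {0..} (\<lambda>t. integral {0..t} (drift k))"
  by (intro continuous_on_half_line_integral drift_integrable) auto

text \<open>
  A jump of \<open>R k\<close> lifts \<open>s k\<close> from a nonnegative left limit to a positive value, where \<open>R k\<close> has no
  atom.
\<close>

lemma push_continuous: "k < d \<Longrightarrow> continuous_on {0..} (push k)"
proof (induction k)
  case 0
  then show ?case by (auto simp: push_def intro!: continuous_intros)
next
  case (Suc k)
  have cad: "cadlag (R (Suc k))" using cadlag_R[of "Suc k"] Suc.prems by simp
  \<comment> \<open>\<open>A\<close> collects all terms of \<open>s (Suc k)\<close> except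
    \<open>R (Suc k)\<close>. It is continuous by the induction hypothesis, so any jump of
    \<open>s (Suc k)\<close> is a jump of \<open>R (Suc k)\<close>.\<close>
  define A where "A t = integral {0..t} (drift (Suc k)) - push k t" for t
  have A: "continuous_on {0..} A"
    unfolding A_def[abs_def] using Suc by (intro continuous_intros drift_integral_continuous) auto
  have s: "s (Suc k) t = A t + R (Suc k) t" if "t \<ge> 0" for t
    using s_eq[of "Suc k" t] Suc.prems that by (simp add: A_def push_def)
  have nonneg: "0 \<le> A u + R (Suc k) u" if "u \<ge> 0" for u
    using s[OF that] s_nonneg[of "Suc k" u] Suc.prems that by simp
  have left: "(R (Suc k) \<longlongrightarrow> R (Suc k) t) (at_left t)" if "t > 0" for t
  proof -
    obtain l where l: "(R (Suc k) \<longlongrightarrow> l) (at_left t)"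
      using cadlag_left_limit[OF cad \<open>t > 0\<close>] by (rule exE)
    have "l = R (Suc k) t"
    proof (cases "s (Suc k) t > 0")
      case True
      then show ?thesis using Suc.prems that
        by (intro complementarity_no_jump[OF cadlag_R R_mono complementarity _ _ l]) simp_all
    next
      \<comment> \<open>Here \<open>A t + R (Suc k) t \<le> 0\<close>, while the left limit
        \<open>A t + l\<close> is nonnegative. Hence \<open>R (Suc k) t \<le> l\<close>, and
        monotonicity gives the converse.\<close>
      case False
      have "(A \<longlongrightarrow> A t) (at t within {0..t})"
        using continuous_on_subset[OF A, of "{0..t}"] that by (auto simp: continuous_on_def)
      then have lim: "((\<lambda>u. A u + R (Suc k) u) \<longlongrightarrow> A t + l) (at_left t)"
        using that l by (intro tendsto_add) (simp_all add: at_within_Icc_at_left)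
      have "0 \<le> A t + l"
      proof (rule tendsto_lowerbound[OF lim])
        show "eventually (\<lambda>u. 0 \<le> A u + R (Suc k) u) (at_left t)"
          by (rule eventually_at_leftI[OF nonneg \<open>t > 0\<close>]) simp
      qed simp
      moreover have "A t + R (Suc k) t \<le> 0" using False s[of t] that by simp
      moreover have "l \<le> R (Suc k) t"
      proof (rule tendsto_upperbound[OF l])
        show "eventually (\<lambda>u. R (Suc k) u \<le> R (Suc k) t) (at_left t)"
          using Suc.prems \<open>t > 0\<close> by (intro eventually_at_leftI[of 0] mono_onD[OF R_mono]) auto
      qed simp
      ultimately show ?thesis by simp
    qed
    then show ?thesis using l by simp
  qed
  have right: "(R (Suc k) \<longlongrightarrow> R (Suc k) t) (at_right t)" if "t \<ge> 0" for t
    using cad that by (simp add: cadlag_def)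
  have "(R (Suc k) \<longlongrightarrow> R (Suc k) t) (at t within {0..})" if "t \<ge> 0" for t
  proof (cases "t = 0")
    case True
    then show ?thesis using right[of 0] by (simp add: at_within_Ici_at_right)
  next
    case False
    then have "(R (Suc k) \<longlongrightarrow> R (Suc k) t) (at t)"
      using filterlim_split_at[OF left right] that by simp
    then show ?thesis by (rule tendsto_within_subset) simp
  qed
  then have "continuous_on {0..} (R (Suc k))" by (simp add: continuous_on_def)
  then show ?case by (simp add: push_def[abs_def])
qed

lemma s_continuous:
  assumes "1 \<le> k" "k < d"
  shows "continuous_on {0..} (s k)"
proof -
  have "continuous_on {0..} (\<lambda>t. integral {0..t} (drift k) + push k t - push (k - 1) t)"
    using assms by (intro continuous_intros drift_integral_continuous push_continuous) auto
  then show ?thesis using s_eq[OF assms] by (subst continuous_on_cong[OF refl]) auto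
qed

lemma R_const:
  "1 \<le> k \<Longrightarrow> k < d \<Longrightarrow> 0 \<le> a \<Longrightarrow> a \<le> b \<Longrightarrow> (\<And>u. a < u \<Longrightarrow> u \<le> b \<Longrightarrow> s k u > 0) \<Longrightarrow> R k a = R k b"
  by (rule complementarity_const_cont[OF cadlag_R R_mono complementarity s_continuous]) auto

lemma s_0: "1 \<le> k \<Longrightarrow> k < d \<Longrightarrow> s k 0 = 0"
  using s_eq[of k 0] R_0[of k] R_0[of "k - 1"] by (auto simp: push_def)

end


section \<open>Convergence to the stationary solution\<close>

text \<open>The inequalities \<open>p_le\<close> and \<open>p_gt\<close> express that
  \<open>p\<close> is the integer part of \<open>\<rho> / \<beta>\<close> without division.\<close>

locale fluid_regime = fluid_limit +
  fixes \<rho> :: real and p :: nat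
  assumes beta_pos: "\<beta> > 0" and lam_eq: "lam = \<mu> * \<rho>" and rho_gt: "2 * \<beta> < \<rho>"
    and p_ge: "2 \<le> p" and p_less: "p < d" and p_le: "real p * \<beta> \<le> \<rho>" and p_gt: "\<rho> < (real p + 1) * \<beta>"
begin

section \<open>A priori bounds and vanishing of the first coordinate\<close>

lemma lam_pos: "lam > 0"
  using lam_eq mu_pos beta_pos rho_gt by simp

lemma push_le: "k < d \<Longrightarrow> 0 \<le> a \<Longrightarrow> a \<le> b \<Longrightarrow> push k a \<le> push k b"
  using lam_pos by (intro mono_onD[OF push_mono_on]) auto

lemma s_increment:
  assumes "1 \<le> k" "k < d" "0 \<le> a" "a \<le> b"
  shows "s k b - s k a = integral {a..b} (drift k) + (push k b - push k a) - (push (k - 1) b - push (k - 1) a)"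
proof -
  have "integral {0..a} (drift k) + integral {a..b} (drift k) = integral {0..b} (drift k)"
    using assms by (intro Henstock_Kurzweil_Integration.integral_combine drift_integrable) auto
  then show ?thesis using s_eq[of k a] s_eq[of k b] assms by simp
qed

text \<open>While \<open>s k\<close> is positive, \<open>R k\<close> is frozen, so
  \<open>s k\<close> gains at most \<open>c * (b - a)\<close> from the drift and loses the increment
  of \<open>push (k - 1)\<close>. The choice \<open>c = 0\<close> serves the upper bounds by
  \<open>\<beta>\<close>; \<open>c = lam\<close> matches the linear \<open>push 0\<close>.\<close>

lemma s_antimono_while_pos:
  assumes k: "1 \<le> k" "k < d" "0 \<le> a" "a < b"
    and pos: "\<And>u. a < u \<Longrightarrow> u \<le> b \<Longrightarrow> s k u > 0"
    and drift: "\<And>u. a \<le> u \<Longrightarrow> u \<le> b \<Longrightarrow> drift k u \<le> c"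
    and push: "c * (b - a) \<le> push (k - 1) b - push (k - 1) a"
  shows "s k b \<le> s k a"
proof -
  have "R k a = R k b" using R_const[of k a b] k pos by simp
  then have "push k a = push k b" using k by (simp add: push_def)
  moreover have "integral {a..b} (drift k) \<le> integral {a..b} (\<lambda>_. c)"
    using k drift by (intro integral_le drift_integrable) auto
  moreover have "integral {a..b} (\<lambda>_. c) = c * (b - a)" using k by simp
  ultimately show ?thesis using s_increment[of k a b] k push by linarith
qed

lemma s1_nonneg: "t \<ge> 0 \<Longrightarrow> s 1 t \<ge> 0"
  using s_nonneg[of 1 t] d_ge by simp

text \<open>Induction downwards from \<open>d\<close>, where \<open>y d = \<beta> - x0\<close> with
  \<open>x0\<close> nonnegative. Where \<open>s k\<close> is at least \<open>\<beta>\<close>, it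
  dominates \<open>y (k + 1)\<close>, so its drift is nonpositive.\<close>

lemma y_le:
  assumes "k \<le> d" "1 \<le> k" "t \<ge> 0"
  shows "y k t \<le> \<beta>"
  using assms
proof (induction k arbitrary: t rule: inc_induct)
  case base
  have "integral {0..t} (s 1) \<ge> 0"
    using d_ge s1_nonneg by (intro integral_nonneg s_integrable) auto
  then show ?case using mu_pos by (simp add: y_def x0_def)
next
  case (step k)
  have "s k t - \<beta> \<le> 0"
  proof (rule nonpos_if_antimono_while_pos[where f = "\<lambda>t. s k t - \<beta>"])
    show "continuous_on {0..} (\<lambda>t. s k t - \<beta>)"
      using step by (intro continuous_intros s_continuous) auto
    show "s k 0 - \<beta> \<le> 0" using s_0[of k] step beta_pos by simp
    fix a b
    assume ab: "0 \<le> a" "a < b" and gt: "\<And>u. a < u \<Longrightarrow> u \<le> b \<Longrightarrow> s k u - \<beta> > 0" and "s k a - \<beta> \<ge> 0"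
    then have ge: "s k u \<ge> \<beta>" if "a \<le> u" "u \<le> b" for u
      using that gt[of u] by (cases "u = a") (auto intro: less_imp_le)
    have "s k b \<le> s k a"
    proof (rule s_antimono_while_pos)
      show "s k u > 0" if "a < u" "u \<le> b" for u using ge[of u] that beta_pos by simp
      show "drift k u \<le> 0" if "a \<le> u" "u \<le> b" for u
      proof -
        have "(real k + 1) * (y (k + 1) u - y k u) \<le> 0"
          using step.IH[of u] ge[OF that] step.hyps step.prems that ab
          by (intro mult_nonneg_nonpos) (auto simp: y_def)
        then show ?thesis using s1_nonneg[of u] that ab mu_pos
          by (auto simp: drift_def intro!: mult_nonneg_nonpos)
      qed
      show "0 * (b - a) \<le> push (k - 1) b - push (k - 1) a"
        using push_le[of "k - 1" a b] step ab by simp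
    qed (use step ab in auto)
    then show "s k b - \<beta> \<le> s k a - \<beta>" by simp
  qed (use step in auto)
  then show ?case using step by (simp add: y_def)
qed

text \<open>The drift of \<open>s 1\<close> is at most \<open>2 * \<mu> * \<beta>\<close>, less than
  the rate \<open>lam\<close> at which \<open>push 0\<close> drains it, so \<open>s 1\<close> cannot
  leave 0.\<close>

lemma s1_zero:
  assumes "t \<ge> 0"
  shows "s 1 t = 0"
proof -
  have "s 1 t \<le> 0"
  proof (rule nonpos_if_antimono_while_pos[OF s_continuous])
    show "s 1 0 \<le> 0" using s_0[of 1] d_ge by simp
    fix a b
    assume ab: "0 \<le> a" "a < b" and pos: "\<And>u. a < u \<Longrightarrow> u \<le> b \<Longrightarrow> s 1 u > 0"
    show "s 1 b \<le> s 1 a"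
    proof (rule s_antimono_while_pos[OF _ _ ab pos])
      show "drift 1 u \<le> lam" if "a \<le> u" "u \<le> b" for u
      proof -
        have "2 * (y 2 u - y 1 u) - s 1 u \<le> \<rho>"
          using y_le[of 2 u] s1_nonneg[of u] that ab d_ge rho_gt by (simp add: y_def)
        then show ?thesis
          using mu_pos by (simp add: drift_def lam_eq numeral_2_eq_2)
      qed
      show "lam * (b - a) \<le> push (1 - 1) b - push (1 - 1) a" by (simp add: push_def algebra_simps)
    qed (use d_ge in auto)
  qed (use d_ge assms in auto)
  then show ?thesis using s1_nonneg[OF assms] by simp
qed

lemma x0_zero: "t \<ge> 0 \<Longrightarrow> x0 t = 0"
  unfolding x0_def using s1_zero by (subst integral_cong[of _ _ "\<lambda>_. 0"]) auto

lemma y_d: "t \<ge> 0 \<Longrightarrow> y d t = \<beta>"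
  by (simp add: y_def x0_zero)

lemma y_continuous:
  assumes "1 \<le> k"
  shows "continuous_on {0..} (y k)"
proof (cases "k < d")
  case True
  then show ?thesis using s_continuous[OF assms] by (simp add: y_def[abs_def])
next
  case False
  then show ?thesis by (auto simp: y_def[abs_def] intro!: continuous_intros x0_continuous)
qed

section \<open>Partial sums and the stationary solution\<close>

definition T where "T k t = (\<Sum>j=1..k. s j t)"

definition rate where "rate k t = \<mu> * ((real k + 1) * y (k + 1) t - T k t) - lam"

lemma T_continuous: "k < d \<Longrightarrow> continuous_on {0..} (T k)"
  unfolding T_def[abs_def] by (intro continuous_intros s_continuous) auto

lemma rate_continuous: "k < d \<Longrightarrow> continuous_on {0..} (rate k)"
  unfolding rate_def[abs_def] by (intro continuous_intros y_continuous T_continuous) auto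

text \<open>Adding the equations for \<open>s j\<close> telescopes the reflection terms down to
  \<open>push k\<close>. Summation by parts turns the drifts into \<open>rate k\<close>, where
  \<open>s 1 = 0\<close> removes the remaining terms.\<close>

lemma T_eq: "k < d \<Longrightarrow> t \<ge> 0 \<Longrightarrow> T k t = integral {0..t} (rate k) + push k t"
proof (induction k)
  case 0
  \<comment> \<open>The base case reads \<open>0 = - lam * t + lam * t\<close>:
    \<open>rate 0\<close> equals \<open>- lam\<close> because \<open>y 1\<close> vanishes, and
    \<open>push 0\<close> cancels it.\<close>
  have "integral {0..t} (rate 0) = integral {0..t} (\<lambda>_. - lam)"
    using d_ge s1_zero by (intro integral_cong) (auto simp: rate_def T_def y_def)
  then show ?case using 0 by (simp add: T_def push_def)
next
  case (Suc k)
  have "integral {0..t} (rate (Suc k)) = integral {0..t} (\<lambda>u. rate k u + drift (Suc k) u)"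
    using s1_zero Suc.prems
    by (intro integral_cong) (auto simp: rate_def drift_def T_def y_def algebra_simps)
  also have "\<dots> = integral {0..t} (rate k) + integral {0..t} (drift (Suc k))"
    using Suc.prems by (intro integral_add drift_integrable integrable_continuous_real
      continuous_on_subset[OF rate_continuous]) auto
  finally show ?case
    using Suc s_eq[of "Suc k" t] by (simp add: T_def)
qed

text \<open>The stationary solution of the obstacle problem for \<^const>\<open>T\<close>:\<close>

definition s_lim where
  "s_lim k = (if k < p then 0 else if k = p then (real p + 1) * \<beta> - \<rho> else \<beta>)"

definition T_lim where "T_lim k = (\<Sum>j=1..k. s_lim j)"

lemma s_lim_nonneg: "s_lim k \<ge> 0"
  using p_gt beta_pos by (simp add: s_lim_def)

lemma T_lim_Suc: "T_lim (Suc k) = T_lim k + s_lim (Suc k)"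
  by (simp add: T_lim_def)

lemma T_lim_less: "k < p \<Longrightarrow> T_lim k = 0"
  by (simp add: T_lim_def s_lim_def)

lemma T_lim_ge: "p \<le> k \<Longrightarrow> T_lim k = (real k + 1) * \<beta> - \<rho>"
proof (induction k rule: dec_induct)
  case base
  have "T_lim p = T_lim (p - 1) + s_lim p"
    using p_ge T_lim_Suc[of "p - 1"] by simp
  then show ?case using p_ge T_lim_less[of "p - 1"] by (simp add: s_lim_def)
next
  case (step n)
  then have "T_lim (Suc n) = T_lim n + \<beta>" by (simp add: T_lim_Suc s_lim_def)
  then show ?case using step.IH by (simp add: algebra_simps)
qed

text \<open>The stationary rate is nonpositive, as the obstacle problem requires. Below
  \<open>p - 1\<close> the left side vanishes, and from \<open>p\<close> on it equals
  \<open>\<rho>\<close>.\<close>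

lemma s_lim_drift: "(real k + 1) * s_lim (k + 1) - T_lim k \<le> \<rho>"
proof -
  \<comment> \<open>This is the case \<open>k = p - 1\<close>; after rearrangement it is
    \<open>p_le\<close> multiplied by \<open>real p + 1\<close>.\<close>
  have "real p * ((real p + 1) * \<beta> - \<rho>) \<le> \<rho>"
    using mult_left_mono[OF p_le, of "real p + 1"] by (simp add: algebra_simps)
  moreover have "0 < \<rho>" using rho_gt beta_pos by simp
  ultimately show ?thesis
    by (cases "p \<le> k") (auto simp: T_lim_ge T_lim_less s_lim_def not_le
      of_nat_diff algebra_simps dest!: Suc_lessI)
qed

lemma s_lim_drift_eq: "p \<le> k \<Longrightarrow> (real k + 1) * s_lim (k + 1) - T_lim k = \<rho>"
  by (simp add: T_lim_ge s_lim_def algebra_simps)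

section \<open>Exponential decay of the deviation\<close>

definition D where "D k t = T k t - T_lim k"

text \<open>The deviation contracts at rate \<open>\<mu>\<close>; half of it leaves a strict
  inequality at a contact. The factor \<open>(real d + 1) * \<beta>\<close> exceeds every
  \<open>T_lim k\<close> with \<open>k < d\<close>, hence the initial deviations.\<close>

definition envelope where "envelope t = (real d + 1) * \<beta> * exp (- (\<mu> / 2) * t)"

lemma envelope_pos: "envelope t > 0"
  using beta_pos by (simp add: envelope_def add_nonneg_pos)

lemma envelope_deriv: "(envelope has_real_derivative - (\<mu> / 2) * envelope t) (at t within S)"
  unfolding envelope_def[abs_def] by (auto intro!: derivative_eq_intros)

lemma envelope_continuous: "continuous_on S envelope"
  by (rule DERIV_continuous_on[OF envelope_deriv])

lemma D_continuous: "k < d \<Longrightarrow> continuous_on {0..} (D k)"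
  unfolding D_def[abs_def] by (intro continuous_intros T_continuous)

lemma D_eq: "k < d \<Longrightarrow> t \<ge> 0 \<Longrightarrow> 1 \<le> k \<Longrightarrow> D k t = integral {0..t} (rate k) + R k t - T_lim k"
  using T_eq[of k t] by (simp add: D_def push_def)

lemma D_Suc: "D (Suc k) t = D k t + (s (Suc k) t - s_lim (Suc k))"
  by (simp add: D_def T_def T_lim_Suc)

lemma T_0: "k < d \<Longrightarrow> T k 0 = 0"
  by (simp add: T_def s_0)

lemma rate_integral_deriv:
  assumes "k < d" "t \<ge> 0"
  shows "((\<lambda>u. integral {0..u} (rate k)) has_real_derivative rate k t) (at t within {0..})"
proof -
  have "((\<lambda>u. integral {0..u} (rate k)) has_real_derivative rate k t) (at t within {0..t + 1})"
    using assms by (intro integral_has_real_derivative continuous_on_subset[OF rate_continuous]) auto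
  moreover have "at t within {0..t + 1} = at t within {0..}"
    using assms by (intro at_within_nhd[of _ "{..<t + 1}"]) auto
  ultimately show ?thesis by simp
qed

text \<open>Subtracting the stationary inequality leaves only deviations. It is one-sided because
  the stationary rate may be negative below \<open>p\<close>; this is the side that bounds
  \<open>D\<close> from above.\<close>

lemma rate_le:
  "rate k t \<le> \<mu> * ((real k + 1) * (y (k + 1) t - s_lim (k + 1)) - D k t)"
proof -
  have "\<mu> * ((real k + 1) * s_lim (k + 1) - T_lim k) \<le> lam"
    using s_lim_drift[of k] mu_pos by (simp add: lam_eq)
  then show ?thesis by (simp add: rate_def D_def algebra_simps)
qed

lemma rate_eq:
  assumes "p \<le> k"
  shows "rate k t = \<mu> * ((real k + 1) * (y (k + 1) t - s_lim (k + 1)) - D k t)"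
proof -
  have "lam = \<mu> * ((real k + 1) * s_lim (k + 1) - T_lim k)"
    using s_lim_drift_eq[OF assms] by (simp add: lam_eq)
  then show ?thesis by (simp add: rate_def D_def algebra_simps)
qed

text \<open>The system closes at \<open>k + 1 = d\<close> because \<open>y d\<close> and
  \<open>s_lim d\<close> both equal \<open>\<beta>\<close>. Elsewhere the difference is nonpositive
  at an index where \<open>D\<close> is maximal, which is the cooperative structure.\<close>

lemma y_diff:
  assumes "k < d" "t \<ge> 0"
  shows "y (k + 1) t - s_lim (k + 1) = (if k + 1 < d then D (k + 1) t - D k t else 0)"
proof (cases "k + 1 < d")
  case True
  then show ?thesis by (simp add: D_Suc y_def)
next
  case False
  then have "k + 1 = d" using assms by simp
  then show ?thesis using y_d[OF assms(2)] p_less by (simp add: s_lim_def)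
qed

text \<open>At a first contact, \<open>D ?k\<close> is the largest deviation, so the neighbour term
  is nonpositive and the rate is at most \<open>- \<mu> * envelope t\<close>. Off the obstacle no
  reflection acts, so \<open>D ?k\<close> would fall faster than the envelope and would have been
  above it before.\<close>

lemma D_less_envelope:
  assumes "1 \<le> k" "k < d" "t \<ge> 0"
  shows "D k t < envelope t"
proof -
  define f where "f k t = D k t - envelope t" for k t
  have "f k t < 0"
  proof (rule neg_if_no_first_contact[of "{1..<d}" f])
    show "continuous_on {0..} (f j)" if "j \<in> {1..<d}" for j
      unfolding f_def[abs_def] using that by (intro continuous_intros D_continuous envelope_continuous) auto
    show "f j 0 < 0" if "j \<in> {1..<d}" for j
    proof -
      have "T_lim j \<ge> 0" unfolding T_lim_def by (intro sum_nonneg s_lim_nonneg)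
      then show ?thesis using that T_0[of j] envelope_pos[of 0] by (simp add: f_def D_def)
    qed
    fix t i
    assume "t > 0" and before: "\<And>j u. j \<in> {1..<d} \<Longrightarrow> 0 \<le> u \<Longrightarrow> u < t \<Longrightarrow> f j u < 0"
      and at: "\<And>j. j \<in> {1..<d} \<Longrightarrow> f j t \<le> 0" and "i \<in> {1..<d}"
    from \<open>i \<in> {1..<d}\<close> show "f i t \<noteq> 0"
    \<comment> \<open>All indices are treated at the same time \<open>t\<close>. The induction
      hypothesis makes the bound on \<open>D i\<close> strict; it starts from
      \<open>D 0 = 0\<close>.\<close>
    proof (induction i)
      case 0
      then show ?case by simp
    next
      case (Suc i)
      let ?k = "Suc i"
      show ?case
      proof
        assume contact: "f ?k t = 0"
        \<comment> \<open>Contact first happens off the obstacle: if \<open>T (i + 1) = T i\<close>, then \<open>D i\<close> would also touch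
          the envelope.\<close>
        have "D i t < envelope t"
        proof (cases "i = 0")
          case True
          then show ?thesis using envelope_pos[of t] by (simp add: D_def T_def T_lim_def)
        next
          case False
          then show ?thesis using Suc at[of i] by (simp add: f_def)
        qed
        then have "s ?k t > 0"
          using contact D_Suc[of i t] s_lim_nonneg[of ?k] by (simp add: f_def)
        moreover have "continuous_on {0..t} (s ?k)"
          using Suc.prems by (intro continuous_on_subset[OF s_continuous]) auto
        then have "(s ?k \<longlongrightarrow> s ?k t) (at_left t)"
          using \<open>t > 0\<close> by (simp add: continuous_on_Icc_at_leftD)
        ultimately have "eventually (\<lambda>u. s ?k u > 0) (at_left t)"
          by (simp add: order_tendstoD)
        then obtain c where c: "0 \<le> c" "c < t" "\<And>u. c < u \<Longrightarrow> u < t \<Longrightarrow> s ?k u > 0"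
          unfolding eventually_at_left[OF \<open>t > 0\<close>]
          by (metis \<open>t > 0\<close> max.bounded_iff max.cobounded1 max_less_iff_conj)
        \<comment> \<open>\<open>q\<close> is the differentiable part of \<open>f ?k\<close>. On the
          interval after \<open>c\<close> where \<open>s ?k\<close> is positive, \<open>R ?k\<close>
          is constant, so both differ by a constant there.\<close>
        define q where "q u = integral {0..u} (rate ?k) - envelope u" for u
        have f_eq: "f ?k u = q u + R ?k u - T_lim ?k" if "u \<ge> 0" for u
          using D_eq[of ?k u] that Suc.prems by (simp add: f_def q_def)
        have "(q has_real_derivative rate ?k t + \<mu> / 2 * envelope t) (at t within {0..})"
          unfolding q_def[abs_def] using Suc.prems \<open>t > 0\<close>
          by (auto intro!: derivative_eq_intros rate_integral_deriv envelope_deriv)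
        moreover have "rate ?k t + \<mu> / 2 * envelope t < 0"
        proof -
          have Dk: "D ?k t = envelope t" using contact by (simp add: f_def)
          have "y (?k + 1) t - s_lim (?k + 1) \<le> 0"
            using y_diff[of ?k t] at[of "?k + 1"] Suc.prems \<open>t > 0\<close> Dk by (auto simp: f_def)
          then have "(real ?k + 1) * (y (?k + 1) t - s_lim (?k + 1)) \<le> 0"
            by (intro mult_nonneg_nonpos) auto
          then have "\<mu> * ((real ?k + 1) * (y (?k + 1) t - s_lim (?k + 1)) - D ?k t) \<le> \<mu> * (- envelope t)"
            using mu_pos Dk by (intro mult_left_mono) auto
          then have "rate ?k t \<le> - (\<mu> * envelope t)" using rate_le[of ?k t] by simp
          moreover have "\<mu> * envelope t > 0" using mu_pos envelope_pos by simp
          ultimately show ?thesis by simp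
        qed
        moreover have "q u \<le> q t" if "c < u" "u < t" for u
        proof -
          have "R ?k u = R ?k t"
          proof (rule R_const)
            show "s ?k v > 0" if "u < v" "v \<le> t" for v
              using that \<open>c < u\<close> c(3)[of v] \<open>s ?k t > 0\<close> by (cases "v = t") auto
          qed (use Suc.prems that c in auto)
          then show ?thesis
            using before[of ?k u] f_eq[of u] f_eq[of t] contact that c Suc.prems by simp
        qed
        ultimately show False using c by (intro not_left_max_if_deriv_neg[of q _ t c]) auto
      qed
    qed
  qed (use assms in auto)
  then show ?thesis by (simp add: f_def)
qed

text \<open>The first contact argument from below needs no discussion of the obstacle: reflection
  only raises \<open>T k\<close>, which moves it away from the lower envelope.\<close>

lemma D_greater_envelope:
  assumes "1 \<le> k" "k < d" "t \<ge> 0"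
  shows "- D k t < envelope t"
proof -
  define f where "f k t = - D k t - envelope t" for k t
  have "f k t < 0"
  proof (rule neg_if_no_first_contact[of "{1..<d}" f])
    show "continuous_on {0..} (f j)" if "j \<in> {1..<d}" for j
      unfolding f_def[abs_def] using that by (intro continuous_intros D_continuous envelope_continuous) auto
    show "f j 0 < 0" if "j \<in> {1..<d}" for j
    proof -
      have "0 < \<rho>" using rho_gt beta_pos by simp
      moreover have "real j * \<beta> \<le> real d * \<beta>" using that beta_pos by (intro mult_right_mono) auto
      moreover have "0 < (real d + 1) * \<beta>" using beta_pos by (simp add: add_nonneg_pos)
      ultimately have "T_lim j < (real d + 1) * \<beta>"
        by (cases "p \<le> j") (simp_all add: T_lim_ge T_lim_less algebra_simps)
      then show ?thesis using that T_0[of j] by (simp add: f_def D_def envelope_def)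
    qed
    fix t k
    assume "t > 0" and before: "\<And>j u. j \<in> {1..<d} \<Longrightarrow> 0 \<le> u \<Longrightarrow> u < t \<Longrightarrow> f j u < 0"
      and at: "\<And>j. j \<in> {1..<d} \<Longrightarrow> f j t \<le> 0" and k: "k \<in> {1..<d}"
    show "f k t \<noteq> 0"
    proof
      assume contact: "f k t = 0"
      then have Dk: "D k t = - envelope t" by (simp add: f_def)
      \<comment> \<open>At contact \<open>T k t < T_lim k\<close>, so nonnegativity of
        \<open>T k t\<close> makes \<open>T_lim k\<close> positive and forces
        \<open>p \<le> k\<close>. There the stationary rate is exactly zero, and
        \<open>rate_eq\<close> gives the lower bound that \<open>rate_le\<close> cannot.\<close>
      have "T k t \<ge> 0"
        unfolding T_def using k \<open>t > 0\<close> by (intro sum_nonneg s_nonneg) auto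
      then have "p \<le> k"
        using Dk envelope_pos[of t] T_lim_less[of k] by (cases "p \<le> k") (auto simp: D_def)
      define q where "q u = - integral {0..u} (rate k) - envelope u" for u
      have f_eq: "f k u = q u - R k u + T_lim k" if "u \<ge> 0" for u
        using D_eq[of k u] that k by (simp add: f_def q_def)
      have "(q has_real_derivative - rate k t + \<mu> / 2 * envelope t) (at t within {0..})"
        unfolding q_def[abs_def] using k \<open>t > 0\<close>
        by (auto intro!: derivative_eq_intros rate_integral_deriv envelope_deriv)
      moreover have "- rate k t + \<mu> / 2 * envelope t < 0"
      proof -
        have "y (k + 1) t - s_lim (k + 1) \<ge> 0"
          using y_diff[of k t] at[of "k + 1"] k \<open>t > 0\<close> Dk by (auto simp: f_def)
        then have "(real k + 1) * (y (k + 1) t - s_lim (k + 1)) \<ge> 0" by simp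
        then have "\<mu> * ((real k + 1) * (y (k + 1) t - s_lim (k + 1)) - D k t) \<ge> \<mu> * envelope t"
          using mu_pos Dk by (intro mult_left_mono) auto
        then have "rate k t \<ge> \<mu> * envelope t" using rate_eq[OF \<open>p \<le> k\<close>, of t] by simp
        moreover have "\<mu> * envelope t > 0" using mu_pos envelope_pos by simp
        ultimately show ?thesis by simp
      qed
      \<comment> \<open>\<open>q\<close> is \<open>f k + R k\<close> up to a constant;
        \<open>f k\<close> is negative before \<open>t\<close> and 0 at \<open>t\<close>, and
        \<open>R k\<close> is nondecreasing.\<close>
      moreover have "q u \<le> q t" if "0 < u" "u < t" for u
      proof -
        have "R k u \<le> R k t" using k that by (intro mono_onD[OF R_mono]) auto
        then show ?thesis
          using before[of k u] f_eq[of u] f_eq[of t] contact that k by simp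
      qed
      ultimately show False using \<open>t > 0\<close> by (intro not_left_max_if_deriv_neg[of q _ t 0]) auto
    qed
  qed (use assms in auto)
  then show ?thesis by (simp add: f_def)
qed

section \<open>Limits of the fluid state\<close>

lemma envelope_tendsto: "(envelope \<longlongrightarrow> 0) at_top"
proof -
  have "LIM t at_top. - (\<mu> / 2) * t :> at_bot"
    using mu_pos by (intro filterlim_tendsto_neg_mult_at_bot[OF tendsto_const] filterlim_ident) auto
  then have "((\<lambda>t. exp (- (\<mu> / 2) * t)) \<longlongrightarrow> 0) at_top"
    by (rule filterlim_compose[OF exp_at_bot])
  then show ?thesis unfolding envelope_def[abs_def] by (rule tendsto_mult_right_zero)
qed

lemma D_tendsto:
  assumes "k < d"
  shows "(D k \<longlongrightarrow> 0) at_top"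
proof (cases "k = 0")
  case True
  then show ?thesis by (simp add: D_def[abs_def] T_def T_lim_def)
next
  case False
  show ?thesis
  proof (rule Lim_null_comparison[OF _ envelope_tendsto])
    show "eventually (\<lambda>t. norm (D k t) \<le> envelope t) at_top"
      using eventually_ge_at_top[of 0]
    proof eventually_elim
      case (elim t)
      then show ?case
        using D_less_envelope[of k t] D_greater_envelope[of k t] assms False by auto
    qed
  qed
qed

lemma s_tendsto:
  assumes "1 \<le> k" "k < d"
  shows "(s k \<longlongrightarrow> s_lim k) at_top"
proof -
  have "((\<lambda>t. D k t - D (k - 1) t + s_lim k) \<longlongrightarrow> 0 - 0 + s_lim k) at_top"
    using assms by (intro tendsto_intros D_tendsto) auto
  moreover have "D k t - D (k - 1) t + s_lim k = s k t" for t
    using D_Suc[of "k - 1" t] assms by simp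
  ultimately show ?thesis by simp
qed

text \<open>The boundary values \<open>s_lim 0 = 0\<close> and \<open>s_lim d = \<beta>\<close> let
  one formula cover \<open>k = 1\<close> and \<open>k = d\<close>; for the latter, \<open>x0\<close>
  vanishes at nonnegative times.\<close>

lemma fluid_state_tendsto:
  assumes "1 \<le> k" "k \<le> d"
  shows "(fluid_state d \<mu> \<beta> s k \<longlongrightarrow> s_lim k - s_lim (k - 1)) at_top"
proof -
  consider "k = 1" | "1 < k" "k < d" | "k = d" "k \<noteq> 1" using assms by linarith
  then show ?thesis
  proof cases
    case 1
    then show ?thesis using s_tendsto[of 1] d_ge p_ge by (simp add: fluid_state_def[abs_def] s_lim_def)
  next
    case 2
    then have "((\<lambda>t. s k t - s (k - 1) t) \<longlongrightarrow> s_lim k - s_lim (k - 1)) at_top"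
      by (intro tendsto_intros s_tendsto) auto
    then show ?thesis using 2 by (simp add: fluid_state_def[abs_def])
  next
    case 3
    have "((\<lambda>t. \<beta> - s (d - 1) t) \<longlongrightarrow> \<beta> - s_lim (d - 1)) at_top"
      using d_ge by (intro tendsto_intros s_tendsto) auto
    moreover have "eventually (\<lambda>t. \<beta> - s (d - 1) t = fluid_state d \<mu> \<beta> s k t) at_top"
      using eventually_ge_at_top[of 0]
      by eventually_elim (use 3 d_ge x0_zero in \<open>simp add: fluid_state_def x0_def\<close>)
    ultimately show ?thesis using 3 p_less by (auto simp: s_lim_def intro: Lim_transform_eventually)
  qed
qed

end

theorem corollary1:
  fixes lam \<mu> \<beta> \<rho> :: real and d p :: nat
    and s R x :: "nat \<Rightarrow> real \<Rightarrow> real"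
  assumes "lam > 0" and "\<mu> > 0" and "\<beta> > 0" and "d \<ge> 3"
    and "\<rho> = lam / \<mu>"
    and "generalized_skorohod_solution (d - 1) (\<lambda>h. G_functional d \<mu> h \<beta> lam) P_matrix s R"
    and "x = fluid_state d \<mu> \<beta> s"
    and "2 * \<mu> * \<beta> < lam" and "lam < real d * \<mu> * \<beta>"
    and "p = nat \<lfloor>\<rho> / \<beta>\<rfloor>"
  shows "((\<lambda>t. (x p t, x (p + 1) t)) \<longlongrightarrow>
            ((real p + 1) * \<beta> - \<rho>, \<rho> - real p * \<beta>)) at_top \<and>
         (\<forall>k\<in>{1..d} - {p, p + 1}. (x k \<longlongrightarrow> 0) at_top)"
proof -
  have lam: "lam = \<mu> * \<rho>" using assms by simp
  have rho: "2 * \<beta> < \<rho>" "\<rho> < real d * \<beta>"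
    using assms(2,8,9) by (simp_all add: lam ac_simps)
  then have two: "2 < \<rho> / \<beta>" and d: "\<rho> / \<beta> < real d"
    using assms(3) by (simp_all add: field_simps)
  \<comment> \<open>Truncation by \<open>nat\<close> is harmless because the quotient exceeds
    2.\<close>
  have p: "real p = of_int \<lfloor>\<rho> / \<beta>\<rfloor>" using assms(10) two by simp
  then have "real p \<le> \<rho> / \<beta>" "\<rho> / \<beta> < real p + 1" by linarith+
  then have le: "real p * \<beta> \<le> \<rho>" "\<rho> < (real p + 1) * \<beta>"
    using assms(3) by (simp_all add: field_simps)
  have "2 \<le> p" "p < d" using p two d by linarith+
  then interpret fluid_regime lam \<mu> \<beta> d s R \<rho> p
    using assms(2-4,6) lam rho(1) le by unfold_locales auto
  have "(x p \<longlongrightarrow> (real p + 1) * \<beta> - \<rho>) at_top"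
    using fluid_state_tendsto[of p] p_ge p_less by (simp add: assms(7) s_lim_def)
  moreover have "(x (p + 1) \<longlongrightarrow> \<rho> - real p * \<beta>) at_top"
    using fluid_state_tendsto[of "p + 1"] p_less by (simp add: assms(7) s_lim_def algebra_simps)
  moreover have "(x k \<longlongrightarrow> 0) at_top" if "k \<in> {1..d} - {p, p + 1}" for k
  proof -
    \<comment> \<open>The profile \<open>s_lim\<close> is 0 before \<open>p\<close> and
      \<open>\<beta>\<close> after it, so it changes only on entering \<open>p\<close> and
      \<open>p + 1\<close>.\<close>
    have "s_lim k - s_lim (k - 1) = 0" using that by (auto simp: s_lim_def)
    then show ?thesis using fluid_state_tendsto[of k] that by (simp add: assms(7))
  qed
  ultimately show ?thesis by (auto intro: tendsto_Pair)
qed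

end
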